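(* Let $\varphi(t)=\left(\frac{q_0(t)}{N(t)},\ldots,\frac{q_{n-1}(t)}{N(t)}\right)$ be a proper parametrization of a primitive hypercircle $\mathcal{U}$ with coefficients in $\mathbb{F}$. Let $I$ be the homogeneous ideal of the rational normal curve of degree $n$ in $\mathbb{P}(\mathbb{F})^n$ given by a set of homogeneous generators $h_1(\bar{Y}),\ldots,h_r(\bar{Y})$. Let $\mathcal{Q}\in\mathcal{M}_{(n+1)\times(n+1)}(\mathbb{F})$ be the matrix that carries $\{q_0(t),\ldots,q_{n-1}(t),N(t)\}$ onto $\{1,t,\ldots,t^n\}$. Let $$f_i(\bar{X})=h_i\left(\sum_{j=0}^{n}\mathcal{Q}_{0j}X_j,\ldots,\sum_{j=0}^{n}\mathcal{Q}_{nj}X_j\right),\quad 1\leq i\leq r.$$ Then $\{f_1,\ldots,f_r\}$ is a set of generators of the homogeneous ideal of $\mathcal{U}$.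
   Context: $\mathbb{K}$ is a field of characteristic zero, $\mathbb{L}=\mathbb{K}(\alpha)$ is a finite algebraic extension of $\mathbb{K}$ of degree $n$ with primitive element $\alpha$, and $\mathbb{F}$ is the algebraic closure of $\mathbb{K}$. A unit of $\mathbb{L}(t)$ (under composition) is a rational function $u(t)=\frac{at+b}{ct+d}$ with $a,b,c,d\in\mathbb{L}$, $ad-bc\neq 0$. Every unit $u(t)\in\mathbb{L}(t)$ is written uniquely as $u(t)=\sum_{i=0}^{n-1}\phi_i(t)\alpha^i$ with $\phi_i(t)\in\mathbb{K}(t)$, and the $\alpha$-hypercircle (or simply hypercircle) generated by $u(t)$ is the rational curve in $\mathbb{F}^n$ parametrized by $(\phi_0(t),\ldots,\phi_{n-1}(t))$ (Zariski closure of the image). A hypercircle is primitive if its degree as a curve equals $n=[\mathbb{K}(\alpha):\mathbb{K}]$. A parametrization is proper if it is almost one-to-one (birational onto the curve). In the claim, $q_0,\ldots,q_{n-1},N$ are polynomials in $\mathbb{F}[t]$, $\bar{Y}=(Y_0,\ldots,Y_n)$, $\bar{X}=(X_0,\ldots,X_n)$, and $\mathcal{Q}=(\mathcal{Q}_{ij})_{0\le i,j\le n}$ satisfies $\mathcal{Q}\,(q_0(t),\ldots,q_{n-1}(t),N(t))^{T}=(1,t,\ldots,t^n)^{T}$. The rational normal curve of degree $n$ in $\mathbb{P}(\mathbb{F})^n$ is the curve parametrized by $[s^n:s^{n-1}t:\cdots:t^n]$. $\mathbb{F}^n$ is embedded in $\mathbb{P}(\mathbb{F})^n$ via $(X_0,\ldots,X_{n-1})\mapsto[X_0:\cdots:X_{n-1}:1]$,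 and the homogeneous ideal of $\mathcal{U}$ is that of its projective closure. *)

theory Defs
  imports
    "HOL-Computational_Algebra.Fraction_Field"
    "HOL-Algebra.Algebraic_Closure_Type"
    "HOL-Algebra.Generated_Fields"
    "HOL-Library.Poly_Mapping"
    "Jordan_Normal_Form.Matrix"
begin

text \<open>Points of affine space $F^n$ are the vectors in \<^term>\<open>carrier_vec n\<close>.  The base field $K$,
  and with it $L = K(\alpha)$, is a subset of the carrier of its algebraic closure $F$, which is
  the type of all scalars.\<close>

section \<open>Multivariate polynomials\<close>

text \<open>A polynomial maps monomials to coefficients, and a monomial maps variable indices to exponents.
  The type has variables for all natural numbers; \<open>mpoly_ring k\<close> cuts out the polynomials in
  the variables with index below \<open>k\<close>.\<close>

type_synonym 'a mpoly = "(nat \<Rightarrow>\<^sub>0 nat) \<Rightarrow>\<^sub>0 'a"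

definition mpoly_ring :: "nat \<Rightarrow> 'a::comm_ring_1 mpoly ring" where
  "mpoly_ring k = \<lparr> carrier = {p. \<forall>m\<in>Poly_Mapping.keys p. Poly_Mapping.keys m \<subseteq> {..<k}},
     monoid.mult = (*), one = 1, zero = 0, add = (+) \<rparr>"

definition mp_const :: "'a::zero \<Rightarrow> 'a mpoly" where
  "mp_const c = Poly_Mapping.single 0 c"

definition mp_var :: "nat \<Rightarrow> 'a::zero_neq_one mpoly" where
  "mp_var i = Poly_Mapping.single (Poly_Mapping.single i 1) 1"

text \<open>\<open>mp_eval \<iota> x p\<close> replaces the \<open>i\<close>-th variable by \<open>x i\<close>, where \<open>\<iota>\<close> embeds the coefficients in
  the ring in which the value lives.\<close>

definition mp_eval :: "('a::zero \<Rightarrow> 'b) \<Rightarrow> (nat \<Rightarrow> 'b) \<Rightarrow> 'a mpoly \<Rightarrow> 'b::comm_semiring_1" where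
  "mp_eval \<iota> x p = (\<Sum>m\<in>Poly_Mapping.keys p. \<iota> (Poly_Mapping.lookup p m) *
     (\<Prod>i\<in>Poly_Mapping.keys m. x i ^ Poly_Mapping.lookup m i))"

definition mp_value :: "'a vec \<Rightarrow> 'a::comm_semiring_1 mpoly \<Rightarrow> 'a" where
  "mp_value v = mp_eval (\<lambda>c. c) (\<lambda>i. v $ i)"

definition mp_subst :: "(nat \<Rightarrow> 'a mpoly) \<Rightarrow> 'a::comm_semiring_1 mpoly \<Rightarrow> 'a mpoly" where
  "mp_subst = mp_eval mp_const"

definition homogeneous :: "'a::zero mpoly \<Rightarrow> bool" where
  "homogeneous p \<longleftrightarrow> (\<exists>d. \<forall>m\<in>Poly_Mapping.keys p.
     (\<Sum>i\<in>Poly_Mapping.keys m. Poly_Mapping.lookup m i) = d)"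

text \<open>This makes \<^const>\<open>genideal\<close> meaningful for \<^const>\<open>mpoly_ring\<close>.\<close>

lemma cring_mpoly_ring: "cring (mpoly_ring k :: 'a::comm_ring_1 mpoly ring)"
proof -
  have prod: "a * b \<in> carrier (mpoly_ring k)"
    if a: "a \<in> carrier (mpoly_ring k)" and b: "b \<in> carrier (mpoly_ring k)" for a b :: "'a mpoly"
  proof -
    have "Poly_Mapping.keys m \<subseteq> {..<k}" if m: "m \<in> Poly_Mapping.keys (a * b)" for m
    proof -
      from m keys_mult[of a b] obtain u v where uv: "m = u + v"
        "u \<in> Poly_Mapping.keys a" "v \<in> Poly_Mapping.keys b"
        by blast
      then have "Poly_Mapping.keys u \<subseteq> {..<k}" "Poly_Mapping.keys v \<subseteq> {..<k}"
        using a b by (simp_all add: mpoly_ring_def)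
      then show ?thesis
        using Poly_Mapping.keys_add[of u v] unfolding uv(1) by (meson Un_least order_trans)
    qed
    then show ?thesis by (simp add: mpoly_ring_def)
  qed
  have plus: "a + b \<in> carrier (mpoly_ring k)"
    if "a \<in> carrier (mpoly_ring k)" "b \<in> carrier (mpoly_ring k)" for a b :: "'a mpoly"
    using that Poly_Mapping.keys_add[of a b] unfolding mpoly_ring_def by fastforce
  have neg: "- a \<in> carrier (mpoly_ring k)"
    if "a \<in> carrier (mpoly_ring k)" for a :: "'a mpoly"
    using that by (simp add: mpoly_ring_def)
  have zero: "0 \<in> carrier (mpoly_ring k)" and one: "1 \<in> carrier (mpoly_ring k)"
    by (simp_all add: mpoly_ring_def)
  have ops: "x \<otimes>\<^bsub>mpoly_ring k\<^esub> y = x * y" "x \<oplus>\<^bsub>mpoly_ring k\<^esub> y = x + y"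
    "\<one>\<^bsub>mpoly_ring k\<^esub> = 1" "\<zero>\<^bsub>mpoly_ring k\<^esub> = 0" for x y :: "'a mpoly"
    by (simp_all add: mpoly_ring_def)
  show ?thesis
  proof (rule cringI)
    show "abelian_group (mpoly_ring k :: 'a mpoly ring)"
    proof (rule abelian_groupI, unfold ops)
      fix x :: "'a mpoly" assume "x \<in> carrier (mpoly_ring k)"
      then show "\<exists>y\<in>carrier (mpoly_ring k). y + x = 0"
        using neg by (intro bexI[of _ "- x"]) simp_all
    qed (simp_all add: plus zero add.assoc add.commute)
    show "comm_monoid (mpoly_ring k :: 'a mpoly ring)"
      by (rule comm_monoidI, unfold ops) (simp_all add: prod one mult.assoc mult.commute)
  qed (simp add: ops distrib_right)
qed

definition generates_ideal :: "nat \<Rightarrow> 'a::comm_ring_1 mpoly set \<Rightarrow> 'a mpoly set \<Rightarrow> bool" where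
  "generates_ideal k S I \<longleftrightarrow> S \<subseteq> carrier (mpoly_ring k) \<and> genideal (mpoly_ring k) S = I"


section \<open>Affine and projective varieties\<close>

definition affine_closed :: "nat \<Rightarrow> 'a::comm_ring_1 vec set \<Rightarrow> bool" where
  "affine_closed n Z \<longleftrightarrow> (\<exists>T \<subseteq> carrier (mpoly_ring n).
     Z = {x \<in> carrier_vec n. \<forall>p\<in>T. mp_value x p = 0})"

definition affine_closure :: "nat \<Rightarrow> 'a::comm_ring_1 vec set \<Rightarrow> 'a vec set" where
  "affine_closure n S = \<Inter>{Z. affine_closed n Z \<and> S \<subseteq> Z}"

text \<open>A projective point is the set of all its vectors of homogeneous coordinates.\<close>

definition proj_point :: "'a::field vec \<Rightarrow> 'a vec set" where
  "proj_point v = {c \<cdot>\<^sub>v v | c. c \<noteq> 0}"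

definition proj_space :: "nat \<Rightarrow> 'a::field vec set set" where
  "proj_space n = proj_point ` (carrier_vec (Suc n) - {0\<^sub>v (Suc n)})"

text \<open>Used for homogeneous \<open>p\<close> only.\<close>

definition vanishes_at :: "'a::field mpoly \<Rightarrow> 'a vec set \<Rightarrow> bool" where
  "vanishes_at p P \<longleftrightarrow> (\<forall>v\<in>P. mp_value v p = 0)"

definition proj_closed :: "nat \<Rightarrow> 'a::field vec set set \<Rightarrow> bool" where
  "proj_closed n Z \<longleftrightarrow> (\<exists>T \<subseteq> {p \<in> carrier (mpoly_ring (Suc n)). homogeneous p}.
     Z = {P \<in> proj_space n. \<forall>p\<in>T. vanishes_at p P})"

definition proj_closure :: "nat \<Rightarrow> 'a::field vec set set \<Rightarrow> 'a vec set set" where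
  "proj_closure n S = \<Inter>{Z. proj_closed n Z \<and> S \<subseteq> Z}"

definition homogeneous_ideal :: "nat \<Rightarrow> 'a::field vec set set \<Rightarrow> 'a mpoly set" where
  "homogeneous_ideal n S = genideal (mpoly_ring (Suc n))
     {p \<in> carrier (mpoly_ring (Suc n)). homogeneous p \<and> (\<forall>P\<in>S. vanishes_at p P)}"

text \<open>The embedding $(x_0,\ldots,x_{n-1}) \mapsto [x_0 : \cdots : x_{n-1} : 1]$.\<close>

definition proj_embed :: "nat \<Rightarrow> 'a::field vec \<Rightarrow> 'a vec set" where
  "proj_embed n x = proj_point (vec (Suc n) (\<lambda>i. if i < n then x $ i else 1))"

definition rational_normal_curve :: "nat \<Rightarrow> 'a::field vec set set" where
  "rational_normal_curve n =
     {proj_point (vec (Suc n) (\<lambda>i. s ^ (n - i) * t ^ i)) | s t. (s, t) \<noteq> (0, 0)}"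

text \<open>The degree of an affine curve is the number of its points on a generic hyperplane
  $a_0 x_0 + \cdots + a_{n-1} x_{n-1} + a_n = 0$; generic means that the coefficient vector $a$ ranges
  over some nonempty Zariski-open set \<open>G \<noteq> 0\<close>.\<close>

definition has_curve_degree :: "nat \<Rightarrow> 'a::field vec set \<Rightarrow> nat \<Rightarrow> bool" where
  "has_curve_degree n C d \<longleftrightarrow> (\<exists>G \<in> carrier (mpoly_ring (Suc n)). G \<noteq> 0 \<and>
     (\<forall>a \<in> carrier_vec (Suc n). mp_value a G \<noteq> 0 \<longrightarrow>
        finite {x \<in> C. (\<Sum>i<n. a $ i * x $ i) + a $ n = 0} \<and>
        card {x \<in> C. (\<Sum>i<n. a $ i * x $ i) + a $ n = 0} = d))"


section \<open>Rational parametrizations\<close>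

text \<open>\<open>rat_value r t y\<close>: the rational function \<open>r\<close> is defined at \<open>t\<close> and takes the value \<open>y\<close> there.
  Some representation of \<open>r\<close> has to have a denominator that does not vanish at \<open>t\<close>; the given one
  need not be reduced.\<close>

definition rat_value :: "'a::field poly fract \<Rightarrow> 'a \<Rightarrow> 'a \<Rightarrow> bool" where
  "rat_value r t y \<longleftrightarrow> (\<exists>p q. r = Fract p q \<and> poly q t \<noteq> 0 \<and> y = poly p t / poly q t)"

definition param_value :: "nat \<Rightarrow> (nat \<Rightarrow> 'a::field poly fract) \<Rightarrow> 'a \<Rightarrow> 'a vec \<Rightarrow> bool" where
  "param_value n \<phi> t x \<longleftrightarrow> x \<in> carrier_vec n \<and> (\<forall>i<n. rat_value (\<phi> i) t (x $ i))"

definition parametrized_variety :: "nat \<Rightarrow> (nat \<Rightarrow> 'a::field poly fract) \<Rightarrow> 'a vec set" where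
  "parametrized_variety n \<phi> = affine_closure n {x. \<exists>t. param_value n \<phi> t x}"

text \<open>Almost one-to-one: all but finitely many parameters share their point with no other parameter.\<close>

definition proper_param :: "nat \<Rightarrow> (nat \<Rightarrow> 'a::field poly fract) \<Rightarrow> bool" where
  "proper_param n \<phi> \<longleftrightarrow> finite {t. \<exists>x s. s \<noteq> t \<and> param_value n \<phi> t x \<and> param_value n \<phi> s x}"


section \<open>Hypercircles\<close>

definition primitive_extension :: "'a::field set \<Rightarrow> 'a \<Rightarrow> 'a set" where
  "primitive_extension K \<alpha> = generate_field ring_of_type_algebra (insert \<alpha> K)"

definition rational_functions_over :: "'a::field set \<Rightarrow> 'a poly fract set" where
  "rational_functions_over K = {Fract p q | p q. q \<noteq> 0 \<and>
     (\<forall>i. Polynomial.coeff p i \<in> K) \<and> (\<forall>i. Polynomial.coeff q i \<in> K)}"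

definition units_over :: "'a::field set \<Rightarrow> 'a poly fract set" where
  "units_over L = {Fract [:b, a:] [:d, c:] | a b c d.
     a \<in> L \<and> b \<in> L \<and> c \<in> L \<and> d \<in> L \<and> a * d - b * c \<noteq> 0}"

text \<open>Here \<open>n\<close> is the degree of \<open>K(\<alpha>)\<close> over \<open>K\<close>.\<close>

definition generates_hypercircle ::
  "'a::field set \<Rightarrow> 'a \<Rightarrow> nat \<Rightarrow> 'a poly fract \<Rightarrow> 'a vec set \<Rightarrow> bool" where
  "generates_hypercircle K \<alpha> n u U \<longleftrightarrow> u \<in> units_over (primitive_extension K \<alpha>) \<and>
     (\<exists>\<phi>. (\<forall>i<n. \<phi> i \<in> rational_functions_over K) \<and>
          u = (\<Sum>i<n. \<phi> i * Fract [:\<alpha>:] 1 ^ i) \<and>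
          U = parametrized_variety n \<phi>)"

definition hypercircle :: "'a::field set \<Rightarrow> 'a \<Rightarrow> nat \<Rightarrow> 'a vec set \<Rightarrow> bool" where
  "hypercircle K \<alpha> n U \<longleftrightarrow> (\<exists>u. generates_hypercircle K \<alpha> n u U)"

definition primitive_hypercircle :: "'a::field set \<Rightarrow> 'a \<Rightarrow> nat \<Rightarrow> 'a vec set \<Rightarrow> bool" where
  "primitive_hypercircle K \<alpha> n U \<longleftrightarrow> hypercircle K \<alpha> n U \<and> has_curve_degree n U n"

end

theory Submission
  imports Defs "Jordan_Normal_Form.Determinant"
begin

text \<open>Since the powers $1, t, \ldots, t^n$ are linearly independent, \<open>Q\<close> is invertible.  Hence
  $q_0, \ldots, q_{n-1}, N$ have no common zero, and \<open>Q\<close> carries the points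
  $[q_0(t) : \cdots : q_{n-1}(t) : N(t)]$ onto the points $[1 : t : \cdots : t^n]$.  A form vanishes
  on the projective closure of either curve as soon as it vanishes at all but finitely many
  of these points, because its restriction to the parametrization is a polynomial in \<open>t\<close>.
  The substitution by \<open>Q\<close> is therefore a ring automorphism that maps the forms vanishing on the
  rational normal curve onto those vanishing on the closure of \<open>U\<close>, and it carries generators
  to generators.\<close>

no_notation fps_nth (infixl \<open>$\<close> 75)

section \<open>Evaluation of multivariate polynomials\<close>

lemma mpoly_ring_simps [simp]:
  fixes x y :: "'a::comm_ring_1 mpoly"
  shows "x \<otimes>\<^bsub>mpoly_ring k\<^esub> y = x * y" "x \<oplus>\<^bsub>mpoly_ring k\<^esub> y = x + y"
    "\<one>\<^bsub>mpoly_ring k\<^esub> = (1 :: 'a mpoly)" "\<zero>\<^bsub>mpoly_ring k\<^esub> = (0 :: 'a mpoly)"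
  by (simp_all add: mpoly_ring_def)

lemma mpoly_eq_sum_single:
  "p = (\<Sum>m\<in>Poly_Mapping.keys p. Poly_Mapping.single m (Poly_Mapping.lookup p m))"
  by (rule poly_mapping_eqI) (simp add: lookup_sum lookup_single when_def in_keys_iff)

text \<open>Every polynomial is a finite sum of terms, so an additive property only has to be
  checked on single terms.\<close>

lemma mpoly_induct [case_names zero single add]:
  assumes "P 0" and "\<And>m c. P (Poly_Mapping.single m c)" and "\<And>p q. P p \<Longrightarrow> P q \<Longrightarrow> P (p + q)"
  shows "P (p :: 'a::comm_monoid_add mpoly)"
proof -
  have "P (\<Sum>m\<in>A. Poly_Mapping.single m (f m))" for A and f :: "_ \<Rightarrow> 'a"
    by (induction A rule: infinite_finite_induct) (use assms in auto)
  then show ?thesis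
    by (subst mpoly_eq_sum_single)
qed

definition monomial_value :: "(nat \<Rightarrow> 'b) \<Rightarrow> (nat \<Rightarrow>\<^sub>0 nat) \<Rightarrow> 'b::comm_semiring_1" where
  "monomial_value x m = (\<Prod>i\<in>Poly_Mapping.keys m. x i ^ Poly_Mapping.lookup m i)"

text \<open>A variable outside the support has exponent 0 and contributes the factor 1. Two
  monomials can thus be compared over a common index set.\<close>

lemma monomial_value_superset:
  assumes "finite A" and "Poly_Mapping.keys m \<subseteq> A"
  shows "monomial_value x m = (\<Prod>i\<in>A. x i ^ Poly_Mapping.lookup m i)"
  unfolding monomial_value_def
  by (rule prod.mono_neutral_left) (use assms in \<open>auto simp: in_keys_iff\<close>)

lemma monomial_value_zero [simp]: "monomial_value x 0 = 1"
  by (simp add: monomial_value_def)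

lemma monomial_value_add: "monomial_value x (m + m') = monomial_value x m * monomial_value x m'"
proof -
  let ?A = "Poly_Mapping.keys m \<union> Poly_Mapping.keys m'"
  have "monomial_value x (m + m') = (\<Prod>i\<in>?A. x i ^ Poly_Mapping.lookup (m + m') i)"
    by (rule monomial_value_superset) (simp_all add: Poly_Mapping.keys_add)
  also have "\<dots> = (\<Prod>i\<in>?A. x i ^ Poly_Mapping.lookup m i) * (\<Prod>i\<in>?A. x i ^ Poly_Mapping.lookup m' i)"
    by (simp add: lookup_add power_add prod.distrib)
  also have "\<dots> = monomial_value x m * monomial_value x m'"
    by (simp add: monomial_value_superset[of ?A])
  finally show ?thesis .
qed

lemma mp_eval_alt:
  "mp_eval \<iota> x p = (\<Sum>m\<in>Poly_Mapping.keys p. \<iota> (Poly_Mapping.lookup p m) * monomial_value x m)"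
  by (simp add: mp_eval_def monomial_value_def)

text \<open>The type has infinitely many variables, while a vector has unspecified entries beyond
  its dimension. Membership in the carrier keeps those entries out of the value.\<close>

lemma mp_eval_cong:
  assumes "p \<in> carrier (mpoly_ring k)" and "\<And>i. i < k \<Longrightarrow> x i = y i"
  shows "mp_eval \<iota> x p = mp_eval \<iota> y p"
  unfolding mp_eval_def
  by (intro sum.cong prod.cong refl arg_cong2[where f = "(*)"] arg_cong2[where f = power])
    (use assms in \<open>auto simp: mpoly_ring_def\<close>)

lemma mp_value_cong:
  assumes "p \<in> carrier (mpoly_ring k)" and "\<And>i. i < k \<Longrightarrow> v $ i = w $ i"
  shows "mp_value v p = mp_value w p"
  unfolding mp_value_def by (rule mp_eval_cong) (use assms in auto)

context comm_semiring_hom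
begin

lemma mp_eval_superset:
  assumes "finite A" and "Poly_Mapping.keys p \<subseteq> A"
  shows "mp_eval hom x p = (\<Sum>m\<in>A. hom (Poly_Mapping.lookup p m) * monomial_value x m)"
  unfolding mp_eval_alt
  by (rule sum.mono_neutral_left) (use assms in \<open>auto simp: in_keys_iff hom_zero\<close>)

lemma mp_eval_single [simp]:
  "mp_eval hom x (Poly_Mapping.single m c) = hom c * monomial_value x m"
  by (simp add: mp_eval_alt hom_zero)

lemma mp_eval_zero [simp]: "mp_eval hom x 0 = 0"
  by (simp add: mp_eval_alt)

lemma mp_eval_add [simp]: "mp_eval hom x (p + q) = mp_eval hom x p + mp_eval hom x q"
proof -
  let ?A = "Poly_Mapping.keys p \<union> Poly_Mapping.keys q"
  have "mp_eval hom x (p + q) = (\<Sum>m\<in>?A. hom (Poly_Mapping.lookup (p + q) m) * monomial_value x m)"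
    by (rule mp_eval_superset) (simp_all add: Poly_Mapping.keys_add)
  then show ?thesis
    by (simp add: lookup_add hom_add distrib_right sum.distrib mp_eval_superset[of ?A])
qed

lemma mp_eval_single_mult:
  "mp_eval hom x (Poly_Mapping.single m c * q) = hom c * monomial_value x m * mp_eval hom x q"
  by (induction q rule: mpoly_induct)
    (simp_all add: mult_single hom_mult monomial_value_add algebra_simps)

text \<open>Both sides are additive in each factor, which reduces the claim to a product of two
  terms. There the exponents add.\<close>

lemma mp_eval_mult [simp]: "mp_eval hom x (p * q) = mp_eval hom x p * mp_eval hom x q"
  by (induction p rule: mpoly_induct) (simp_all add: mp_eval_single_mult distrib_right)

lemma mp_eval_one [simp]: "mp_eval hom x 1 = 1"
  using mp_eval_single[of x 0 1] by (simp add: hom_one)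

lemma comm_semiring_hom_mp_eval: "comm_semiring_hom (mp_eval hom x)"
  by unfold_locales simp_all

lemma mp_eval_const [simp]: "mp_eval hom x (mp_const c) = hom c"
  by (simp add: mp_const_def)

lemma mp_eval_var [simp]: "mp_eval hom x (mp_var i) = x i"
  by (simp add: mp_var_def hom_one monomial_value_def)

text \<open>Here \<open>hom\<close> acts on the values and \<open>\<iota>\<close> is arbitrary.
  Taking for \<open>hom\<close> the evaluation at a point, a substitution, or the evaluation of
  univariate polynomials at \<open>t\<close> yields \<open>mp_value_subst\<close>,
  \<open>mp_subst_subst\<close> and \<open>poly_mp_eval\<close>.\<close>

lemma hom_mp_eval: "hom (mp_eval \<iota> x p) = mp_eval (\<lambda>c. hom (\<iota> c)) (\<lambda>i. hom (x i)) p"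
  by (simp add: mp_eval_def hom_sum hom_mult hom_prod hom_power)

end

lemma comm_semiring_hom_mp_const: "comm_semiring_hom (mp_const :: 'a::comm_ring_1 \<Rightarrow> 'a mpoly)"
  by unfold_locales (simp_all add: mp_const_def single_add mult_single)

lemma comm_semiring_hom_id: "comm_semiring_hom (\<lambda>c. c)"
  by unfold_locales simp_all

lemma comm_semiring_hom_poly: "comm_semiring_hom (\<lambda>p::'a::comm_ring_1 poly. poly p t)"
  by unfold_locales simp_all

lemma monomial_value_mp_var:
  "monomial_value mp_var m = (Poly_Mapping.single m 1 :: 'a::comm_ring_1 mpoly)"
proof -
  have power: "(mp_var i :: 'a mpoly) ^ e = Poly_Mapping.single (Poly_Mapping.single i e) 1" for i e
    by (induction e) (simp_all add: mp_var_def mult_single flip: single_add)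
  have "(\<Prod>i\<in>A. (mp_var i :: 'a mpoly) ^ f i)
      = Poly_Mapping.single (\<Sum>i\<in>A. Poly_Mapping.single i (f i)) 1" for A f
    by (induction A rule: infinite_finite_induct) (simp_all add: power mult_single)
  moreover have "(\<Sum>i\<in>Poly_Mapping.keys m. Poly_Mapping.single i (Poly_Mapping.lookup m i)) = m"
    by (rule poly_mapping_eqI) (simp add: lookup_sum lookup_single when_def in_keys_iff)
  ultimately show ?thesis
    by (simp add: monomial_value_def)
qed

lemma mp_eval_mp_var: "mp_eval mp_const mp_var p = (p :: 'a::comm_ring_1 mpoly)"
proof -
  have "mp_eval mp_const mp_var p
      = (\<Sum>m\<in>Poly_Mapping.keys p. Poly_Mapping.single m (Poly_Mapping.lookup p m))"
    by (simp add: mp_eval_alt monomial_value_mp_var mp_const_def mult_single)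
  then show ?thesis
    by (simp flip: mpoly_eq_sum_single)
qed

lemma mp_value_subst:
  "mp_value v (mp_subst s p) = mp_value (vec k (\<lambda>i. mp_value v (s i))) p"
  if "p \<in> carrier (mpoly_ring k)" for p :: "'a::comm_ring_1 mpoly"
proof -
  interpret id: comm_semiring_hom "\<lambda>c::'a. c" by (rule comm_semiring_hom_id)
  interpret comm_semiring_hom "mp_eval (\<lambda>c::'a. c) (\<lambda>i. v $ i)"
    by (rule id.comm_semiring_hom_mp_eval)
  show ?thesis
    unfolding mp_value_def mp_subst_def hom_mp_eval id.mp_eval_const
    by (rule mp_eval_cong[OF that]) simp
qed

lemma mp_subst_subst:
  "mp_subst s (mp_subst s' p) = mp_subst (\<lambda>i. mp_subst s (s' i)) p" for p :: "'a::comm_ring_1 mpoly"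
proof -
  interpret const: comm_semiring_hom "mp_const :: 'a \<Rightarrow> 'a mpoly"
    by (rule comm_semiring_hom_mp_const)
  interpret comm_semiring_hom "mp_eval (mp_const :: 'a \<Rightarrow> 'a mpoly) s"
    by (rule const.comm_semiring_hom_mp_eval)
  show ?thesis
    by (simp add: mp_subst_def hom_mp_eval)
qed

lemma poly_mp_eval:
  "poly (mp_eval (\<lambda>c. [:c:]) P p) t = mp_value (vec k (\<lambda>i. poly (P i) t)) p"
  if "p \<in> carrier (mpoly_ring k)" for p :: "'a::comm_ring_1 mpoly"
proof -
  interpret comm_semiring_hom "\<lambda>p::'a poly. poly p t" by (rule comm_semiring_hom_poly)
  show ?thesis
    unfolding mp_value_def hom_mp_eval by (simp, rule mp_eval_cong[OF that]) simp
qed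

text \<open>Restricted to the curve, \<open>p\<close> becomes a univariate polynomial
  \<open>g\<close>. The product \<open>g * D\<close> vanishes everywhere on an infinite field, so it
  is zero, and hence \<open>g\<close> is zero. This closes the gaps at the finitely many zeros of
  \<open>D\<close>.\<close>

lemma mp_value_curve_zero:
  fixes p :: "'a::field_char_0 mpoly"
  assumes "p \<in> carrier (mpoly_ring k)" and "D \<noteq> 0"
    and "\<And>t. poly D t \<noteq> 0 \<Longrightarrow> mp_value (vec k (\<lambda>i. poly (P i) t)) p = 0"
  shows "mp_value (vec k (\<lambda>i. poly (P i) t)) p = 0"
proof -
  define g where "g = mp_eval (\<lambda>c. [:c:]) P p"
  have g: "poly g t = mp_value (vec k (\<lambda>i. poly (P i) t)) p" for t
    unfolding g_def by (rule poly_mp_eval) fact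
  have "poly (g * D) t = 0" for t
    using assms(3)[of t] by (auto simp: g)
  then have "g * D = 0"
    using poly_all_0_iff_0 by blast
  then show ?thesis
    using \<open>D \<noteq> 0\<close> g[of t] by simp
qed


section \<open>The graded polynomial ring\<close>

context
  fixes k :: nat and R :: "'a::comm_ring_1 mpoly ring"
  defines "R \<equiv> mpoly_ring k"
begin

interpretation cring R
  unfolding R_def by (rule cring_mpoly_ring)

lemma mpoly_one_closed: "1 \<in> carrier R"
  by (simp add: R_def mpoly_ring_def)

lemma mpoly_mult_closed: "p \<in> carrier R \<Longrightarrow> q \<in> carrier R \<Longrightarrow> p * q \<in> carrier R"
  using m_closed[of p q] by (simp add: R_def)

lemma mpoly_sum_closed: "(\<And>i. i \<in> A \<Longrightarrow> f i \<in> carrier R) \<Longrightarrow> sum f A \<in> carrier R"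
  using zero_closed a_closed
  by (induction A rule: infinite_finite_induct) (auto simp: R_def)

lemma mpoly_power_closed: "p \<in> carrier R \<Longrightarrow> p ^ e \<in> carrier R"
  by (induction e) (simp_all add: mpoly_mult_closed mpoly_one_closed)

lemma mpoly_prod_closed: "(\<And>i. i \<in> A \<Longrightarrow> f i \<in> carrier R) \<Longrightarrow> prod f A \<in> carrier R"
  by (induction A rule: infinite_finite_induct) (auto simp: mpoly_mult_closed mpoly_one_closed)

lemma mp_const_closed: "mp_const c \<in> carrier R"
  by (simp add: R_def mpoly_ring_def mp_const_def)

lemma mp_var_closed: "i < k \<Longrightarrow> mp_var i \<in> carrier R"
  by (simp add: R_def mpoly_ring_def mp_var_def)

text \<open>The numbers of variables before and after may differ: dehomogenization leads from
  \<open>Suc n\<close> variables to \<open>n\<close>.\<close>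

lemma mp_subst_closed:
  assumes "p \<in> carrier (mpoly_ring l)" and "\<And>i. i < l \<Longrightarrow> s i \<in> carrier R"
  shows "mp_subst s p \<in> carrier R"
  unfolding mp_subst_def mp_eval_def
  using assms
  by (intro mpoly_sum_closed mpoly_mult_closed mpoly_prod_closed mpoly_power_closed mp_const_closed)
    (auto simp: mpoly_ring_def)

end

text \<open>The degree is named because summands must share it and factors add it up. The zero
  polynomial has every degree.\<close>

definition homogeneous_of_degree :: "nat \<Rightarrow> 'a::zero mpoly \<Rightarrow> bool" where
  "homogeneous_of_degree d p \<longleftrightarrow> (\<forall>m\<in>Poly_Mapping.keys p.
     (\<Sum>i\<in>Poly_Mapping.keys m. Poly_Mapping.lookup m i) = d)"

lemma homogeneous_iff_degree: "homogeneous p \<longleftrightarrow> (\<exists>d. homogeneous_of_degree d p)"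
  by (simp add: homogeneous_def homogeneous_of_degree_def)

lemma monomial_degree_add:
  "(\<Sum>i\<in>Poly_Mapping.keys (m + m'). Poly_Mapping.lookup (m + m') i) =
    (\<Sum>i\<in>Poly_Mapping.keys m. Poly_Mapping.lookup m i) +
    (\<Sum>i\<in>Poly_Mapping.keys m'. Poly_Mapping.lookup m' i :: nat)"
proof -
  let ?A = "Poly_Mapping.keys m \<union> Poly_Mapping.keys m'"
  have super: "(\<Sum>i\<in>Poly_Mapping.keys u. Poly_Mapping.lookup u i) = (\<Sum>i\<in>?A. Poly_Mapping.lookup u i)"
    if "Poly_Mapping.keys u \<subseteq> ?A" for u :: "_ \<Rightarrow>\<^sub>0 nat"
    by (rule sum.mono_neutral_left) (use that in \<open>auto simp: in_keys_iff\<close>)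
  show ?thesis
    unfolding super[of "m + m'", OF Poly_Mapping.keys_add] super[of m, OF Un_upper1] super[of m', OF Un_upper2]
    by (simp add: sum.distrib lookup_add)
qed

lemma homogeneous_of_degree_mult:
  "homogeneous_of_degree d p \<Longrightarrow> homogeneous_of_degree e q \<Longrightarrow> homogeneous_of_degree (d + e) (p * q)"
  for p q :: "'a::comm_ring_1 mpoly"
  using keys_mult[of p q]
  by (auto simp: homogeneous_of_degree_def monomial_degree_add dest!: subsetD)

lemma homogeneous_of_degree_sum:
  "(\<And>i. i \<in> A \<Longrightarrow> homogeneous_of_degree d (f i)) \<Longrightarrow> homogeneous_of_degree d (sum f A)"
  for f :: "_ \<Rightarrow> 'a::comm_ring_1 mpoly"
proof (induction A rule: infinite_finite_induct)
  case (insert a A)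
  then show ?case
    using Poly_Mapping.keys_add[of "f a" "sum f A"] by (auto simp: homogeneous_of_degree_def)
qed (simp_all add: homogeneous_of_degree_def)

lemma homogeneous_of_degree_const: "homogeneous_of_degree 0 (mp_const c)"
  by (simp add: homogeneous_of_degree_def mp_const_def)

lemma homogeneous_of_degree_one: "homogeneous_of_degree 0 (1 :: 'a::comm_ring_1 mpoly)"
  by (simp add: homogeneous_of_degree_def)

lemma homogeneous_of_degree_var: "homogeneous_of_degree 1 (mp_var i :: 'a::comm_ring_1 mpoly)"
  by (simp add: homogeneous_of_degree_def mp_var_def)

lemma homogeneous_of_degree_power:
  "homogeneous_of_degree 1 p \<Longrightarrow> homogeneous_of_degree e (p ^ e)" for p :: "'a::comm_ring_1 mpoly"
proof (induction e)
  case 0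
  then show ?case by (simp add: homogeneous_of_degree_one)
next
  case (Suc e)
  then show ?case using homogeneous_of_degree_mult[of 1 p e "p ^ e"] by simp
qed

lemma homogeneous_of_degree_prod:
  fixes f :: "_ \<Rightarrow> 'a::comm_ring_1 mpoly"
  assumes "finite A" and "\<And>i. i \<in> A \<Longrightarrow> homogeneous_of_degree (d i) (f i)"
  shows "homogeneous_of_degree (sum d A) (prod f A)"
  using assms
proof (induction A rule: finite_induct)
  case empty
  then show ?case by (simp add: homogeneous_of_degree_one)
qed (simp add: homogeneous_of_degree_mult)

text \<open>A monomial of degree \<open>d\<close> turns into a product of \<open>d\<close> forms of
  degree 1.\<close>

lemma homogeneous_of_degree_subst:
  fixes p :: "'a::comm_ring_1 mpoly"
  assumes p: "homogeneous_of_degree d p" and s: "\<And>i. homogeneous_of_degree 1 (s i)"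
  shows "homogeneous_of_degree d (mp_subst s p)"
  unfolding mp_subst_def mp_eval_def
proof (rule homogeneous_of_degree_sum)
  fix m assume m: "m \<in> Poly_Mapping.keys p"
  have "homogeneous_of_degree (\<Sum>i\<in>Poly_Mapping.keys m. Poly_Mapping.lookup m i)
      (\<Prod>i\<in>Poly_Mapping.keys m. s i ^ Poly_Mapping.lookup m i)"
    by (intro homogeneous_of_degree_prod homogeneous_of_degree_power s) simp
  with p m have "homogeneous_of_degree d (\<Prod>i\<in>Poly_Mapping.keys m. s i ^ Poly_Mapping.lookup m i)"
    by (simp add: homogeneous_of_degree_def)
  from homogeneous_of_degree_mult[OF homogeneous_of_degree_const this]
  show "homogeneous_of_degree d (mp_const (Poly_Mapping.lookup p m) *
      (\<Prod>i\<in>Poly_Mapping.keys m. s i ^ Poly_Mapping.lookup m i))"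
    by simp
qed

text \<open>A form of degree \<open>d\<close> satisfies p(c v) = c^d p(v). Its vanishing can
  therefore be tested on any one coordinate vector of a projective point.\<close>

lemma mp_value_smult_zero:
  fixes p :: "'a::comm_ring_1 mpoly"
  assumes p: "p \<in> carrier (mpoly_ring k)" "homogeneous p"
    and v: "v \<in> carrier_vec k" "mp_value v p = 0"
  shows "mp_value (c \<cdot>\<^sub>v v) p = 0"
proof -
  from p(2) obtain d where d: "homogeneous_of_degree d p"
    by (auto simp: homogeneous_iff_degree)
  have "(\<Prod>i\<in>Poly_Mapping.keys m. (c \<cdot>\<^sub>v v) $ i ^ Poly_Mapping.lookup m i) =
      c ^ d * (\<Prod>i\<in>Poly_Mapping.keys m. v $ i ^ Poly_Mapping.lookup m i)"
    if m: "m \<in> Poly_Mapping.keys p" for m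
  proof -
    have "(\<Prod>i\<in>Poly_Mapping.keys m. (c \<cdot>\<^sub>v v) $ i ^ Poly_Mapping.lookup m i) =
        (\<Prod>i\<in>Poly_Mapping.keys m. c ^ Poly_Mapping.lookup m i * v $ i ^ Poly_Mapping.lookup m i)"
      by (rule prod.cong) (use m p(1) v(1) in \<open>auto simp: mpoly_ring_def power_mult_distrib subset_iff\<close>)
    also have "\<dots> = c ^ d * (\<Prod>i\<in>Poly_Mapping.keys m. v $ i ^ Poly_Mapping.lookup m i)"
      using d m by (simp add: prod.distrib power_sum homogeneous_of_degree_def flip: power_sum)
    finally show ?thesis .
  qed
  then have "mp_value (c \<cdot>\<^sub>v v) p = c ^ d * mp_value v p"
    unfolding mp_value_def mp_eval_def sum_distrib_left by (intro sum.cong) (simp_all add: ac_simps)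
  then show ?thesis using v(2) by simp
qed

lemma vanishes_at_proj_point_iff:
  assumes "p \<in> carrier (mpoly_ring k)" "homogeneous p" "v \<in> carrier_vec k"
  shows "vanishes_at p (proj_point v) \<longleftrightarrow> mp_value v p = 0"
proof
  assume "vanishes_at p (proj_point v)"
  moreover have "v \<in> proj_point v"
    unfolding proj_point_def by (rule CollectI, rule exI[of _ 1]) simp
  ultimately show "mp_value v p = 0"
    by (simp add: vanishes_at_def)
qed (use mp_value_smult_zero[OF assms] in \<open>auto simp: vanishes_at_def proj_point_def\<close>)


section \<open>Linear substitutions\<close>

text \<open>This is composition of \<open>p\<close> with the linear map given by \<open>A\<close>:
  row \<open>k\<close> supplies the linear form that replaces variable \<open>k\<close>. With
  \<open>A = Q\<close> it turns \<open>h i\<close> into \<open>f i\<close>.\<close>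

definition linear_subst :: "nat \<Rightarrow> 'a mat \<Rightarrow> 'a::comm_ring_1 mpoly \<Rightarrow> 'a mpoly" where
  "linear_subst n A = mp_subst (\<lambda>k. \<Sum>j\<le>n. mp_const (A $$ (k, j)) * mp_var j)"

lemma linear_subst_closed:
  "p \<in> carrier (mpoly_ring (Suc n)) \<Longrightarrow> linear_subst n A p \<in> carrier (mpoly_ring (Suc n))"
  unfolding linear_subst_def
  by (erule mp_subst_closed)
    (auto intro!: mpoly_sum_closed mpoly_mult_closed mp_const_closed mp_var_closed)

lemma linear_subst_homogeneous: "homogeneous p \<Longrightarrow> homogeneous (linear_subst n A p)"
  using homogeneous_of_degree_mult[OF homogeneous_of_degree_const homogeneous_of_degree_var]
  unfolding linear_subst_def homogeneous_iff_degree
  by (metis (no_types, lifting) add_0 homogeneous_of_degree_subst homogeneous_of_degree_sum)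

lemma mp_value_linear_subst:
  fixes p :: "'a::comm_ring_1 mpoly"
  assumes p: "p \<in> carrier (mpoly_ring (Suc n))"
    and A: "A \<in> carrier_mat (Suc n) (Suc n)" and v: "v \<in> carrier_vec (Suc n)"
  shows "mp_value v (linear_subst n A p) = mp_value (A *\<^sub>v v) p"
proof -
  interpret id: comm_semiring_hom "\<lambda>c::'a. c" by (rule comm_semiring_hom_id)
  interpret comm_semiring_hom "mp_value v"
    unfolding mp_value_def by (rule id.comm_semiring_hom_mp_eval)
  have "mp_value v (\<Sum>j\<le>n. mp_const (A $$ (k, j)) * mp_var j) = (A *\<^sub>v v) $ k" if "k < Suc n" for k
  proof -
    have "mp_value v (\<Sum>j\<le>n. mp_const (A $$ (k, j)) * mp_var j) = (\<Sum>j\<le>n. A $$ (k, j) * v $ j)"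
      unfolding hom_sum hom_mult by (simp add: mp_value_def)
    then show ?thesis
      using that A v by (simp add: scalar_prod_def atLeast0LessThan lessThan_Suc_atMost)
  qed
  then show ?thesis
    unfolding linear_subst_def mp_value_subst[OF p] by (intro mp_value_cong[OF p]) simp
qed

text \<open>Composition reverses the order: substituting by \<open>A\<close> first and by
  \<open>B\<close> afterwards amounts to the linear forms of \<open>A * B\<close>, which here are
  the variables themselves.\<close>

lemma linear_subst_inverse:
  fixes p :: "'a::comm_ring_1 mpoly"
  assumes p: "p \<in> carrier (mpoly_ring (Suc n))"
    and A: "A \<in> carrier_mat (Suc n) (Suc n)" and B: "B \<in> carrier_mat (Suc n) (Suc n)"
    and AB: "A * B = 1\<^sub>m (Suc n)"
  shows "linear_subst n B (linear_subst n A p) = p"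
proof -
  let ?lin = "\<lambda>M k. \<Sum>j\<le>n. mp_const (M $$ (k, j)) * mp_var j :: 'a mpoly"
  interpret const: comm_semiring_hom "mp_const :: 'a \<Rightarrow> 'a mpoly"
    by (rule comm_semiring_hom_mp_const)
  interpret comm_semiring_hom "mp_subst s :: 'a mpoly \<Rightarrow> 'a mpoly" for s
    unfolding mp_subst_def by (rule const.comm_semiring_hom_mp_eval)
  have "mp_subst (?lin B) (?lin A k) = mp_var k" if k: "k < Suc n" for k
  proof -
    have "mp_subst (?lin B) (?lin A k) = (\<Sum>j\<le>n. mp_const (A $$ (k, j)) * ?lin B j)"
      unfolding hom_sum hom_mult by (simp add: mp_subst_def)
    also have "\<dots> = (\<Sum>l\<le>n. \<Sum>j\<le>n. mp_const (A $$ (k, j)) * mp_const (B $$ (j, l)) * mp_var l)"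
      unfolding sum_distrib_left by (subst sum.swap) (simp add: mult.assoc)
    also have "\<dots> = (\<Sum>l\<le>n. mp_const (\<Sum>j\<le>n. A $$ (k, j) * B $$ (j, l)) * mp_var l)"
      by (simp add: const.hom_sum const.hom_mult sum_distrib_right)
    also have "\<dots> = (\<Sum>l\<le>n. mp_const (1\<^sub>m (Suc n) $$ (k, l)) * mp_var l)"
      using k A B unfolding AB[symmetric]
      by (simp add: scalar_prod_def atLeast0LessThan lessThan_Suc_atMost)
    also have "\<dots> = (\<Sum>l\<le>n. if l = k then mp_var l else 0)"
      using k by (intro sum.cong) (auto simp: mp_const_def)
    finally show ?thesis using k by simp
  qed
  then have "mp_subst (\<lambda>k. mp_subst (?lin B) (?lin A k)) p = mp_subst mp_var p"
    unfolding mp_subst_def by (intro mp_eval_cong[OF p])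
  then show ?thesis
    by (simp add: linear_subst_def mp_subst_subst) (simp add: mp_subst_def mp_eval_mp_var)
qed

lemma linear_subst_ring_hom:
  "ring_hom_ring (mpoly_ring (Suc n)) (mpoly_ring (Suc n)) (linear_subst n A)"
proof -
  interpret const: comm_semiring_hom "mp_const :: 'a::comm_ring_1 \<Rightarrow> 'a mpoly"
    by (rule comm_semiring_hom_mp_const)
  interpret comm_semiring_hom "linear_subst n A"
    unfolding linear_subst_def mp_subst_def by (rule const.comm_semiring_hom_mp_eval)
  show ?thesis
    by (intro ring_hom_ringI cring.axioms(1) cring_mpoly_ring)
      (simp_all add: linear_subst_closed hom_add hom_mult)
qed

section \<open>Generated ideals under ring homomorphisms\<close>

lemma (in ring_hom_ring) image_genideal_subset:
  assumes "A \<subseteq> carrier R"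
  shows "h ` genideal R A \<subseteq> genideal S (h ` A)"
proof -
  have "h ` A \<subseteq> carrier S"
    using assms by auto
  \<comment> \<open>The preimage of an ideal is an ideal, and this one contains \<open>A\<close>, so
    it contains the ideal generated by \<open>A\<close>.\<close>
  then have "ideal {r \<in> carrier R. h r \<in> genideal S (h ` A)} R"
    and "h ` A \<subseteq> genideal S (h ` A)"
    by (auto intro!: ideal_vimage S.genideal_ideal S.genideal_self)
  then have "genideal R A \<subseteq> {r \<in> carrier R. h r \<in> genideal S (h ` A)}"
    using assms by (intro R.genideal_minimal) auto
  then show ?thesis by auto
qed

text \<open>This permits exchanging the finite family of the \<open>h i\<close> for the set of all
  forms vanishing on the rational normal curve before the substitution is applied.\<close>

lemma (in ring_hom_ring) genideal_image_cong:
  assumes "A \<subseteq> carrier R" "B \<subseteq> carrier R" "genideal R A = genideal R B"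
  shows "genideal S (h ` A) = genideal S (h ` B)"
proof -
  have "genideal S (h ` A) \<subseteq> genideal S (h ` B)"
    if "A \<subseteq> carrier R" "B \<subseteq> carrier R" "genideal R A = genideal R B" for A B
  proof (rule S.genideal_minimal)
    show "ideal (genideal S (h ` B)) S"
      using that by (auto intro!: S.genideal_ideal)
    show "h ` A \<subseteq> genideal S (h ` B)"
      using image_genideal_subset[OF that(2)] R.genideal_self[OF that(1)] that(3) by blast
  qed
  from this[OF assms] this[OF assms(2,1) assms(3)[symmetric]] show ?thesis by blast
qed


section \<open>Homogeneous equations of the two curves\<close>

text \<open>The points with \<open>s = 1\<close> give the powers of \<open>t\<close>. Only the point
  with \<open>s = 0\<close> is missing from them, and it is reached as a limit in
  \<open>s\<close>.\<close>

lemma vanishes_on_rational_normal_curve_iff: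
  fixes p :: "'a::field_char_0 mpoly"
  assumes p: "p \<in> carrier (mpoly_ring (Suc n))" "homogeneous p"
  shows "(\<forall>P\<in>rational_normal_curve n. vanishes_at p P) \<longleftrightarrow>
    (\<forall>t. mp_value (vec (Suc n) (\<lambda>i. t ^ i)) p = 0)"
proof
  assume *: "\<forall>P\<in>rational_normal_curve n. vanishes_at p P"
  have "proj_point (vec (Suc n) (\<lambda>i. 1 ^ (n - i) * t ^ i)) \<in> rational_normal_curve n" for t :: 'a
    unfolding rational_normal_curve_def by (rule CollectI, rule exI[of _ 1], rule exI[of _ t]) simp
  with * have "vanishes_at p (proj_point (vec (Suc n) (\<lambda>i. 1 ^ (n - i) * t ^ i)))" for t
    by blast
  then show "\<forall>t. mp_value (vec (Suc n) (\<lambda>i. t ^ i)) p = 0"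
    by (simp add: vanishes_at_proj_point_iff[OF p])
next
  assume *: "\<forall>t. mp_value (vec (Suc n) (\<lambda>i. t ^ i)) p = 0"
  have "mp_value (vec (Suc n) (\<lambda>i. s ^ (n - i) * t ^ i)) p = 0" for s t
  proof -
    \<comment> \<open>Now \<open>t\<close> is fixed and \<open>s\<close> is the curve parameter, so
      that \<open>[:0, 1:]\<close> stands for \<open>s\<close>, and the value at
      \<open>s = 0\<close> follows from those at all other \<open>s\<close>.\<close>
    let ?P = "\<lambda>i. [:0, 1:] ^ (n - i) * [:t:] ^ i"
    have "mp_value (vec (Suc n) (\<lambda>i. poly (?P i) s)) p = 0"
    proof (rule mp_value_curve_zero[OF p(1), of "[:0, 1:]"])
      fix s :: 'a assume "poly [:0, 1:] s \<noteq> 0"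
      then have "s \<noteq> 0" by simp
      \<comment> \<open>Dividing the coordinates by s^n leaves the powers of t/s.\<close>
      then have "vec (Suc n) (\<lambda>i. poly (?P i) s) = s ^ n \<cdot>\<^sub>v vec (Suc n) (\<lambda>i. (t / s) ^ i)"
        by (intro eq_vecI) (auto simp: power_diff power_divide less_Suc_eq_le)
      then show "mp_value (vec (Suc n) (\<lambda>i. poly (?P i) s)) p = 0"
        using * by (simp add: mp_value_smult_zero[OF p])
    qed simp
    then show ?thesis by simp
  qed
  then show "\<forall>P\<in>rational_normal_curve n. vanishes_at p P"
    by (auto simp: rational_normal_curve_def vanishes_at_proj_point_iff[OF p])
qed

abbreviation homogenize_vec :: "nat \<Rightarrow> 'a::field vec \<Rightarrow> 'a vec" where
  "homogenize_vec n x \<equiv> vec (Suc n) (\<lambda>i. if i < n then x $ i else 1)"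

text \<open>The zero set of a single form is closed, so it contains the closure of every set that it
  contains.\<close>

lemma vanishes_on_proj_closure_iff:
  assumes p: "p \<in> carrier (mpoly_ring (Suc n))" "homogeneous p"
  shows "(\<forall>P\<in>proj_closure n (proj_embed n ` U). vanishes_at p P) \<longleftrightarrow>
    (\<forall>x\<in>U. mp_value (homogenize_vec n x) p = 0)"
proof -
  have embed: "vanishes_at p (proj_embed n x) \<longleftrightarrow> mp_value (homogenize_vec n x) p = 0" for x
    unfolding proj_embed_def by (rule vanishes_at_proj_point_iff[OF p]) simp
  have space: "proj_embed n x \<in> proj_space n" for x :: "'a vec"
  proof -
    have "homogenize_vec n x $ n \<noteq> 0\<^sub>v (Suc n) $ n" by simp
    then have "homogenize_vec n x \<noteq> 0\<^sub>v (Suc n)" by metis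
    then show ?thesis unfolding proj_embed_def proj_space_def by (intro imageI) simp
  qed
  have closed: "proj_closed n {P \<in> proj_space n. vanishes_at p P}"
    unfolding proj_closed_def by (rule exI[of _ "{p}"]) (use p in auto)
  show ?thesis
  proof
    assume "\<forall>P\<in>proj_closure n (proj_embed n ` U). vanishes_at p P"
    then show "\<forall>x\<in>U. mp_value (homogenize_vec n x) p = 0"
      by (auto simp: proj_closure_def simp flip: embed)
  next
    assume "\<forall>x\<in>U. mp_value (homogenize_vec n x) p = 0"
    then have "proj_embed n ` U \<subseteq> {P \<in> proj_space n. vanishes_at p P}"
      by (auto simp: embed space)
    with closed show "\<forall>P\<in>proj_closure n (proj_embed n ` U). vanishes_at p P"
      by (auto simp: proj_closure_def)
  qed
qed

lemma vanishes_on_affine_closure_iff: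
  fixes p :: "'a::field mpoly"
  assumes p: "p \<in> carrier (mpoly_ring (Suc n))" and S: "S \<subseteq> carrier_vec n"
  shows "(\<forall>x\<in>affine_closure n S. mp_value (homogenize_vec n x) p = 0) \<longleftrightarrow>
    (\<forall>x\<in>S. mp_value (homogenize_vec n x) p = 0)"
proof -
  \<comment> \<open>Setting the last variable to 1 dehomogenizes \<open>p\<close>; the zero set of
    \<open>g\<close> is an affine closed set.\<close>
  define g where "g = mp_subst (\<lambda>i. if i < n then mp_var i else 1) p"
  have g_closed: "g \<in> carrier (mpoly_ring n)"
    unfolding g_def by (rule mp_subst_closed[OF p]) (simp add: mp_var_closed mpoly_one_closed)
  have "mp_value x (if i < n then mp_var i else 1) = (if i < n then x $ i else 1)" for x :: "'a vec" and i
  proof -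
    interpret id: comm_semiring_hom "\<lambda>c::'a. c" by (rule comm_semiring_hom_id)
    show ?thesis
      by (cases "i < n") (simp_all only: mp_value_def id.mp_eval_var id.mp_eval_one if_True if_False)
  qed
  then have g: "mp_value x g = mp_value (homogenize_vec n x) p" for x
    by (simp add: g_def mp_value_subst[OF p])
  have closed: "affine_closed n {x \<in> carrier_vec n. mp_value x g = 0}"
    unfolding affine_closed_def by (rule exI[of _ "{g}"]) (use g_closed in auto)
  show ?thesis
  proof
    assume "\<forall>x\<in>affine_closure n S. mp_value (homogenize_vec n x) p = 0"
    then show "\<forall>x\<in>S. mp_value (homogenize_vec n x) p = 0"
      by (auto simp: affine_closure_def)
  next
    assume "\<forall>x\<in>S. mp_value (homogenize_vec n x) p = 0"
    then have "S \<subseteq> {x \<in> carrier_vec n. mp_value x g = 0}"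
      using S by (auto simp: g)
    with closed have "affine_closure n S \<subseteq> {x \<in> carrier_vec n. mp_value x g = 0}"
      by (auto simp: affine_closure_def)
    then show "\<forall>x\<in>affine_closure n S. mp_value (homogenize_vec n x) p = 0"
      by (auto simp: g)
  qed
qed

text \<open>By \<open>coprime\<close> the numerators and the denominator have no common zero, so
  cancelling common factors does not enlarge the set of admissible parameters.\<close>

lemma vanishes_on_parametrized_variety_iff:
  fixes p :: "'a::field_char_0 mpoly"
  assumes p: "p \<in> carrier (mpoly_ring (Suc n))" "homogeneous p"
    and coprime: "\<And>t. \<exists>j\<le>n. poly (if j < n then q j else N) t \<noteq> 0" and N: "N \<noteq> 0"
  shows "(\<forall>P\<in>proj_closure n (proj_embed n ` parametrized_variety n (\<lambda>i. Fract (q i) N)).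
      vanishes_at p P) \<longleftrightarrow>
    (\<forall>t. mp_value (vec (Suc n) (\<lambda>j. poly (if j < n then q j else N) t)) p = 0)"
proof -
  let ?S = "{x. \<exists>t. param_value n (\<lambda>i. Fract (q i) N) t x}"
  let ?P = "\<lambda>j. if j < n then q j else N"
  have scale: "vec (Suc n) (\<lambda>j. poly (?P j) t) = poly N t \<cdot>\<^sub>v homogenize_vec n x"
    if "poly N t \<noteq> 0" and "\<And>i. i < n \<Longrightarrow> x $ i = poly (q i) t / poly N t" for t x
    using that by (intro eq_vecI) auto
  have nonzero: "poly N t \<noteq> 0" and quotient: "\<And>i. i < n \<Longrightarrow> x $ i = poly (q i) t / poly N t"
    if x: "param_value n (\<lambda>i. Fract (q i) N) t x" for t x
  proof -
    \<comment> \<open>The value at \<open>t\<close> may come from another representation a/b of the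
      same fraction. Cross-multiplication and division by b(t) give an identity that is valid even
      if N(t) = 0.\<close>
    have cross: "poly (q i) t = x $ i * poly N t" if i: "i < n" for i
    proof -
      from x i obtain a b where ab: "Fract (q i) N = Fract a b" "poly b t \<noteq> 0" "x $ i = poly a t / poly b t"
        unfolding param_value_def rat_value_def by blast
      then have "q i * b = a * N"
        using N by (subst (asm) eq_fract) auto
      then have "poly (q i) t * poly b t = poly a t * poly N t"
        by (metis poly_mult)
      moreover have "poly a t = x $ i * poly b t"
        using ab by simp
      ultimately have "poly (q i) t * poly b t = x $ i * poly N t * poly b t"
        by (simp add: ac_simps)
      then show ?thesis
        using ab(2) by simp
    qed
    \<comment> \<open>If N(t) were 0, \<open>cross\<close> would make every q_i(t) vanish as well,
      contradicting \<open>coprime\<close>.\<close>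
    then show nz: "poly N t \<noteq> 0"
      using coprime[of t] by (auto split: if_splits)
    show "x $ i = poly (q i) t / poly N t" if "i < n" for i
      using cross[OF that] nz by simp
  qed
  have "(\<forall>P\<in>proj_closure n (proj_embed n ` parametrized_variety n (\<lambda>i. Fract (q i) N)).
      vanishes_at p P) \<longleftrightarrow> (\<forall>x\<in>?S. mp_value (homogenize_vec n x) p = 0)"
    unfolding vanishes_on_proj_closure_iff[OF p] parametrized_variety_def
    by (rule vanishes_on_affine_closure_iff[OF p(1)]) (auto simp: param_value_def)
  also have "\<dots> \<longleftrightarrow> (\<forall>t. mp_value (vec (Suc n) (\<lambda>j. poly (?P j) t)) p = 0)"
  proof
    assume *: "\<forall>x\<in>?S. mp_value (homogenize_vec n x) p = 0"
    show "\<forall>t. mp_value (vec (Suc n) (\<lambda>j. poly (?P j) t)) p = 0"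
    \<comment> \<open>With \<open>N\<close> as the exceptional polynomial, only parameters with N(t)
      nonzero have to be checked; at these the point lies in \<open>?S\<close>.\<close>
    proof (rule allI, rule mp_value_curve_zero[OF p(1) N])
      fix t assume t: "poly N t \<noteq> 0"
      let ?x = "vec n (\<lambda>i. poly (q i) t / poly N t)"
      have "param_value n (\<lambda>i. Fract (q i) N) t ?x"
        using t by (auto simp: param_value_def rat_value_def)
      then have "mp_value (homogenize_vec n ?x) p = 0"
        using * by blast
      then show "mp_value (vec (Suc n) (\<lambda>j. poly (?P j) t)) p = 0"
        using t by (subst scale[of t ?x]) (simp_all add: mp_value_smult_zero[OF p])
    qed
  next
    assume *: "\<forall>t. mp_value (vec (Suc n) (\<lambda>j. poly (?P j) t)) p = 0"
    show "\<forall>x\<in>?S. mp_value (homogenize_vec n x) p = 0"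
    proof
      fix x assume "x \<in> ?S"
      then obtain t where t: "param_value n (\<lambda>i. Fract (q i) N) t x" by blast
      have "homogenize_vec n x = inverse (poly N t) \<cdot>\<^sub>v vec (Suc n) (\<lambda>j. poly (?P j) t)"
        using nonzero[OF t] by (subst scale[of t x]) (auto simp: quotient[OF t] smult_smult_assoc)
      then show "mp_value (homogenize_vec n x) p = 0"
        using * by (simp add: mp_value_smult_zero[OF p])
    qed
  qed
  finally show ?thesis .
qed

section \<open>Invertibility of the matrix\<close>

lemma powers_image_imp_invertible:
  fixes Q :: "'a::field_char_0 mat"
  assumes Q: "Q \<in> carrier_mat (Suc n) (Suc n)"
    and v: "\<And>t. Q *\<^sub>v v t = vec (Suc n) (\<lambda>i. t ^ i)" "\<And>t. v t \<in> carrier_vec (Suc n)"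
  obtains B where "B \<in> carrier_mat (Suc n) (Suc n)" "B * Q = 1\<^sub>m (Suc n)"
proof -
  \<comment> \<open>Otherwise the transpose of \<open>Q\<close> kills some nonzero \<open>w\<close>.
    Moving \<open>Q\<close> across the scalar product shows that the polynomial with coefficients
    \<open>w\<close> vanishes at every \<open>t\<close>, which forces \<open>w = 0\<close>.\<close>
  have "det Q \<noteq> 0"
  proof
    assume "det Q = 0"
    then have "det (transpose_mat Q) = 0"
      using Q by (simp add: det_transpose)
    then obtain w where w: "w \<in> carrier_vec (Suc n)" "w \<noteq> 0\<^sub>v (Suc n)" "transpose_mat Q *\<^sub>v w = 0\<^sub>v (Suc n)"
      using det_0_iff_vec_prod_zero_field[of "transpose_mat Q" "Suc n"] Q by auto
    have "(\<Sum>i\<le>n. w $ i * t ^ i) = 0" for t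
    proof -
      have "(\<Sum>i\<le>n. w $ i * t ^ i) = w \<bullet> (Q *\<^sub>v v t)"
        unfolding v by (simp add: scalar_prod_def atLeast0LessThan lessThan_Suc_atMost)
      also have "\<dots> = (transpose_mat Q *\<^sub>v w) \<bullet> v t"
        using transpose_vec_mult_scalar[OF Q v(2) w(1)] by simp
      finally show ?thesis
        using w(3) v(2)[of t] by simp
    qed
    then have "poly (\<Sum>i\<le>n. Polynomial.monom (w $ i) i) t = 0" for t
      by (simp add: poly_sum poly_monom)
    then have "(\<Sum>i\<le>n. Polynomial.monom (w $ i) i) = 0"
      using poly_all_0_iff_0 by blast
    then have coeff: "Polynomial.coeff (\<Sum>i\<le>n. Polynomial.monom (w $ i) i) j = 0" for j
      by simp
    have "w $ j = 0" if "j \<le> n" for j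
      using coeff[of j] that by (simp add: coeff_sum)
    then have "w = 0\<^sub>v (Suc n)"
      using w(1) by (intro eq_vecI) auto
    with w(2) show False ..
  qed
  then have "Q \<in> Units (ring_mat TYPE('a) (Suc n) ())"
    by (rule det_non_zero_imp_unit[OF Q])
  then show ?thesis
    using that by (auto simp: Units_def ring_mat_simps)
qed

section \<open>Transport of the generators from the rational normal curve to
  \<open>U\<close>\<close>

theorem theorem5p4:
  fixes K :: "'a::field_char_0 set" and \<alpha> :: 'a and n r :: nat
    and q :: "nat \<Rightarrow> 'a poly" and N :: "'a poly" and U :: "'a vec set"
    and Q :: "'a mat" and h f :: "nat \<Rightarrow> 'a mpoly"
  assumes "algebraic_closure (ring_of_type_algebra :: 'a ring) K"
    and "ring.dimension ring_of_type_algebra n K (primitive_extension K \<alpha>)"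
    and "primitive_hypercircle K \<alpha> n U"
    and "N \<noteq> 0"
    and "U = parametrized_variety n (\<lambda>i. Fract (q i) N)"
    and "proper_param n (\<lambda>i. Fract (q i) N)"
    and "\<forall>i\<in>{1..r}. homogeneous (h i)"
    and "generates_ideal (Suc n) (h ` {1..r}) (homogeneous_ideal n (rational_normal_curve n))"
    and "Q \<in> carrier_mat (Suc n) (Suc n)"
    and "map_mat (\<lambda>c. [:c:]) Q *\<^sub>v vec (Suc n) (\<lambda>j. if j < n then q j else N) =
           vec (Suc n) (\<lambda>i. Polynomial.monom 1 i)"
    and "\<forall>i\<in>{1..r}. f i = mp_subst (\<lambda>k. \<Sum>j\<le>n. mp_const (Q $$ (k, j)) * mp_var j) (h i)"
  shows "generates_ideal (Suc n) (f ` {1..r})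
           (homogeneous_ideal n (proj_closure n (proj_embed n ` U)))"
proof -
  let ?P = "\<lambda>j. if j < n then q j else N"
  let ?R = "mpoly_ring (Suc n) :: 'a mpoly ring"
  let ?C = "proj_closure n (proj_embed n ` U)"
  let ?H = "\<lambda>Z. {p \<in> carrier ?R. homogeneous p \<and> (\<forall>P\<in>Z. vanishes_at p P)}"
  \<comment> \<open>This coordinate vector is a polynomial in \<open>t\<close> and is also available
    at the zeros of \<open>N\<close>, where the affine formula breaks down.\<close>
  define v where "v t = vec (Suc n) (\<lambda>j. poly (?P j) t)" for t
  note Q = assms(9)
  have v_closed: "v t \<in> carrier_vec (Suc n)" for t
    by (simp add: v_def)
  \<comment> \<open>The matrix identity between polynomials is evaluated at \<open>t\<close>, entry
    by entry.\<close>
  have Qv: "Q *\<^sub>v v t = vec (Suc n) (\<lambda>i. t ^ i)" for t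
  proof (rule eq_vecI)
    fix i assume "i < dim_vec (vec (Suc n) (\<lambda>i. t ^ i))"
    then have i: "i < Suc n" by simp
    have "poly ((map_mat (\<lambda>c. [:c:]) Q *\<^sub>v vec (Suc n) ?P) $ i) t = t ^ i"
      unfolding assms(10) using i by (simp add: poly_monom)
    moreover have "poly ((map_mat (\<lambda>c. [:c:]) Q *\<^sub>v vec (Suc n) ?P) $ i) t = (Q *\<^sub>v v t) $ i"
      using i Q by (simp add: scalar_prod_def v_def poly_sum if_distrib cong: if_cong)
    ultimately show "(Q *\<^sub>v v t) $ i = vec (Suc n) (\<lambda>i. t ^ i) $ i"
      using i by simp
  qed (use Q in simp)
  obtain B where B: "B \<in> carrier_mat (Suc n) (Suc n)" "B * Q = 1\<^sub>m (Suc n)"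
    using powers_image_imp_invertible[OF Q Qv v_closed] .
  have coprime: "\<exists>j\<le>n. poly (?P j) t \<noteq> 0" for t
  proof (rule ccontr)
    assume "\<not> (\<exists>j\<le>n. poly (?P j) t \<noteq> 0)"
    then have "v t = 0\<^sub>v (Suc n)"
      by (intro eq_vecI) (auto simp: v_def less_Suc_eq_le)
    \<comment> \<open>Entry 0 of the image is t^0 = 1, so \<open>v t\<close> cannot be the zero
      vector.\<close>
    then have "(Q *\<^sub>v v t) $ 0 = 0"
      using Q by (simp add: scalar_prod_def)
    then show False
      by (simp add: Qv)
  qed
  \<comment> \<open>Both memberships reduce to vanishing along a parametrization, and the value of
    the substituted form at \<open>v t\<close> is the value of \<open>p\<close> at the vector of
    powers of \<open>t\<close>.\<close>
  have subst_mem: "linear_subst n Q p \<in> ?H ?C \<longleftrightarrow> p \<in> ?H (rational_normal_curve n)"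
    if p: "p \<in> carrier ?R" "homogeneous p" for p
  proof -
    note p' = linear_subst_closed[OF p(1), of Q] linear_subst_homogeneous[OF p(2), of n Q]
    have "linear_subst n Q p \<in> ?H ?C \<longleftrightarrow> (\<forall>t. mp_value (v t) (linear_subst n Q p) = 0)"
      using vanishes_on_parametrized_variety_iff[OF p' coprime \<open>N \<noteq> 0\<close>] p'
      by (simp add: assms(5) v_def)
    also have "\<dots> \<longleftrightarrow> (\<forall>t. mp_value (vec (Suc n) (\<lambda>i. t ^ i)) p = 0)"
      by (simp add: mp_value_linear_subst[OF p(1) Q v_closed] Qv)
    also have "\<dots> \<longleftrightarrow> p \<in> ?H (rational_normal_curve n)"
      using vanishes_on_rational_normal_curve_iff[OF p] p by simp
    finally show ?thesis .
  qed
  have image: "linear_subst n Q ` ?H (rational_normal_curve n) = ?H ?C"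
  proof (intro equalityI subsetI)
    fix p assume p: "p \<in> ?H ?C"
    let ?g = "linear_subst n B p"
    \<comment> \<open>Here \<open>B\<close> is substituted first and \<open>Q\<close> second, which
      calls for the product \<open>B * Q\<close>.\<close>
    have "linear_subst n Q ?g = p"
      using p B Q by (auto intro: linear_subst_inverse)
    moreover have "?g \<in> carrier ?R" "homogeneous ?g"
      using p by (auto intro: linear_subst_closed linear_subst_homogeneous)
    ultimately show "p \<in> linear_subst n Q ` ?H (rational_normal_curve n)"
      using subst_mem[of ?g] p by (intro image_eqI[of _ _ ?g]) (simp_all only:)
  next
    fix p assume "p \<in> linear_subst n Q ` ?H (rational_normal_curve n)"
    then obtain g where "p = linear_subst n Q g" and g: "g \<in> ?H (rational_normal_curve n)"
      by (rule imageE)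
    then show "p \<in> ?H ?C"
      using subst_mem[of g] by blast
  qed
  interpret ring_hom_ring ?R ?R "linear_subst n Q"
    by (rule linear_subst_ring_hom)
  have h: "h ` {1..r} \<subseteq> carrier ?R" "genideal ?R (h ` {1..r}) = genideal ?R (?H (rational_normal_curve n))"
    using assms(8) by (auto simp: generates_ideal_def homogeneous_ideal_def)
  have f: "f ` {1..r} = linear_subst n Q ` h ` {1..r}"
    unfolding image_image by (rule image_cong) (use assms(11) in \<open>auto simp: linear_subst_def\<close>)
  \<comment> \<open>The \<open>h i\<close> and all forms vanishing on the rational normal curve
    generate the same ideal; hence so do their images, and by \<open>image\<close> the second image
    consists of all forms vanishing on the closure of \<open>U\<close>.\<close>
  have "genideal ?R (f ` {1..r}) = genideal ?R (?H ?C)"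
    unfolding f image[symmetric] by (rule genideal_image_cong) (use h in auto)
  moreover have "f ` {1..r} \<subseteq> carrier ?R"
    using h(1) unfolding f by (auto intro: linear_subst_closed)
  ultimately show ?thesis
    by (simp add: generates_ideal_def homogeneous_ideal_def)
qed

end
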